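(* Let $\epsilon=1/9$. There is a constant $\Lambda>0$ such that the following holds. Let $U\subset\mathbb{R}^3$ be open and let $u:U\to\mathbb{R}$ be a smooth function such that at every point of $U$ the Hessian eigenvalues satisfy $\lambda(D^2u)=(\lambda_1,\lambda_2,\lambda_3)\in P_2^{1/2}$ and $(\lambda_1+\lambda_2)(\lambda_1+\lambda_3)(\lambda_2+\lambda_3)=1$. Let $x_0\in U$ be a point at which $D^2u$ is diagonal, with $u_{ij}(x_0)=\lambda_i\delta_{ij}$ and $\lambda_1=\max_{1\le i\le 3}\lambda_i$. If $\lambda_1\ge\Lambda$, then at $x_0$ $$-\sum_{p,q=1}^3F^{pp,qq}\,\xi_p\xi_q+2\sum_{i=2}^3\frac{F^{ii}\xi_i^2}{\lambda_1-\lambda_i}-(1+\epsilon)\frac{F^{11}\xi_1^2}{\lambda_1}\ \ge\ 0,$$ where $\xi=(\xi_1,\xi_2,\xi_3)=(u_{111},u_{221},u_{331})$ is evaluated at $x_0$.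
   Context: The cone $P_2^{1/2}$ is $$P_2^{1/2}:=\Big\{\lambda\in\mathbb{R}^3:\ \lambda_{i_1}+\lambda_{i_2}>0\ \ \forall\, i_1\ne i_2,\ \text{ and }\ \lambda_{\min}\ge -\tfrac12\lambda_{\max}\Big\},$$ where $\lambda_{\max}$ and $\lambda_{\min}$ are the maximum and minimum of $\lambda_1,\lambda_2,\lambda_3$. Write $F(D^2u)=f(\lambda(D^2u))=(\lambda_1+\lambda_2)(\lambda_1+\lambda_3)(\lambda_2+\lambda_3)$, where $\lambda(D^2u)$ are the eigenvalues of $D^2u$, and $F^{ij}=\frac{\partial F}{\partial u_{ij}}$, $F^{ij,rs}=\frac{\partial^2F}{\partial u_{ij}\partial u_{rs}}$. At a point where $D^2u$ is diagonal, with diagonal entries $\lambda_i$, one has $F^{ii}=\partial f/\partial\lambda_i$ and $F^{pp,qq}=\partial^2 f/\partial\lambda_p\partial\lambda_q$, evaluated at $(\lambda_1,\lambda_2,\lambda_3)$. Subscripts on $u$ denote partial derivatives. *)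

theory Defs
  imports "HOL-Analysis.Analysis"
begin

definition partial_deriv :: "'n \<Rightarrow> (real ^ 'n \<Rightarrow> real) \<Rightarrow> real ^ 'n \<Rightarrow> real" where
  "partial_deriv i u x = deriv (\<lambda>t. u (x + t *\<^sub>R axis i 1)) 0"

text \<open>For open \<open>U\<close> this is the usual class \<open>C\<^sup>k(U)\<close>, up to requiring Frechet
  differentiability at each step; the two readings of \<open>C\<^sup>\<infinity>(U)\<close> coincide.\<close>

primrec Ck_on :: "nat \<Rightarrow> (real ^ 'n \<Rightarrow> real) \<Rightarrow> (real ^ 'n) set \<Rightarrow> bool" where
  "Ck_on 0 u U \<longleftrightarrow> continuous_on U u"
| "Ck_on (Suc k) u U \<longleftrightarrow> u differentiable_on U \<and> (\<forall>i. Ck_on k (partial_deriv i u) U)"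

definition smooth_on :: "(real ^ 'n \<Rightarrow> real) \<Rightarrow> (real ^ 'n) set \<Rightarrow> bool" where
  "smooth_on u U \<longleftrightarrow> (\<forall>k. Ck_on k u U)"

definition hessian :: "(real ^ 'n \<Rightarrow> real) \<Rightarrow> real ^ 'n \<Rightarrow> real ^ 'n ^ 'n" where
  "hessian u x = (\<chi> i j. partial_deriv j (partial_deriv i u) x)"

text \<open>\<open>l\<close> lists the eigenvalues of \<open>A\<close> with algebraic multiplicity, in some order, as the
  roots of the characteristic polynomial. Everything below is symmetric in the entries of
  \<open>l\<close>, so the order is immaterial.\<close>

definition eigenvalue_vector :: "real ^ 'n ^ 'n \<Rightarrow> real ^ 'n \<Rightarrow> bool" where
  "eigenvalue_vector A l \<longleftrightarrow> (\<forall>t. det (mat t - A) = (\<Prod>i\<in>UNIV. t - l $ i))"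

definition P2_half :: "(real ^ 3) set" where
  "P2_half = {l. (\<forall>i j. i \<noteq> j \<longrightarrow> l $ i + l $ j > 0) \<and>
     Min (range (($) l)) \<ge> - (1 / 2) * Max (range (($) l))}"

definition f_op :: "real ^ 3 \<Rightarrow> real" where
  "f_op l = (l $ 1 + l $ 2) * (l $ 1 + l $ 3) * (l $ 2 + l $ 3)"

text \<open>Meaningful on matrices with real spectrum, in particular on symmetric ones.\<close>

definition F_op :: "real ^ 3 ^ 3 \<Rightarrow> real" where
  "F_op A = f_op (SOME l. eigenvalue_vector A l)"

text \<open>\<open>F_op\<close> is a function of symmetric matrices, so the derivative in the entry
  \<open>(i, j)\<close> is taken along the symmetrised matrix unit. For \<open>i = j\<close> this is the plain
  matrix unit.\<close>

definition sym_unit :: "'n \<Rightarrow> 'n \<Rightarrow> real ^ 'n ^ 'n" where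
  "sym_unit i j = (\<chi> r s. (of_bool (r = i \<and> s = j) + of_bool (r = j \<and> s = i)) / 2)"

definition entry_deriv :: "'n \<Rightarrow> 'n \<Rightarrow> (real ^ 'n ^ 'n \<Rightarrow> real) \<Rightarrow> real ^ 'n ^ 'n \<Rightarrow> real" where
  "entry_deriv i j G A = deriv (\<lambda>t. G (A + t *\<^sub>R sym_unit i j)) 0"

definition F1 :: "3 \<Rightarrow> 3 \<Rightarrow> real ^ 3 ^ 3 \<Rightarrow> real" where
  "F1 i j = entry_deriv i j F_op"

definition F2 :: "3 \<Rightarrow> 3 \<Rightarrow> 3 \<Rightarrow> 3 \<Rightarrow> real ^ 3 ^ 3 \<Rightarrow> real" where
  "F2 i j r s = entry_deriv r s (entry_deriv i j F_op)"

end

theory Submission imports Defs begin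

text \<open>Put \<open>a = \<lambda>\<^sub>2 + \<lambda>\<^sub>3\<close>, \<open>b = \<lambda>\<^sub>1 + \<lambda>\<^sub>3\<close>, \<open>c = \<lambda>\<^sub>1 + \<lambda>\<^sub>2\<close>, so that \<open>f = abc = 1\<close>, and
  \<open>x = (\<xi>\<^sub>2 + \<xi>\<^sub>3)/a\<close>, \<open>y = (\<xi>\<^sub>1 + \<xi>\<^sub>3)/b\<close>, \<open>z = (\<xi>\<^sub>1 + \<xi>\<^sub>2)/c\<close>. Differentiating the equation
  along the first axis gives \<open>x + y + z = 0\<close>, hence \<open>-\<Sum> F\<^sup>p\<^sup>p\<^sup>,\<^sup>q\<^sup>q \<xi>\<^sub>p \<xi>\<^sub>q\<close> equals
  \<open>-2(xy + xz + yz) = 2(y\<^sup>2 + yz + z\<^sup>2) \<ge> 6yz\<close>, which is at least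
  \<open>3(\<xi>\<^sub>1\<^sup>2 - \<xi>\<^sub>2\<^sup>2 - \<xi>\<^sub>3\<^sup>2)/(bc)\<close>. The cone condition makes \<open>b\<close> and \<open>c\<close> at least \<open>\<lambda>\<^sub>1/2\<close>, so \<open>a = 1/(bc)\<close> is
  small: the negative term is about \<open>20/9 \<xi>\<^sub>1\<^sup>2/(bc)\<close>, and the \<open>1/a\<close> in \<open>F\<^sup>2\<^sup>2\<close> and \<open>F\<^sup>3\<^sup>3\<close>
  absorbs the terms in \<open>\<xi>\<^sub>2\<^sup>2\<close> and \<open>\<xi>\<^sub>3\<^sup>2\<close>.\<close>

section \<open>Spectra of diagonal matrices\<close>

definition diag :: "real ^ 'n \<Rightarrow> real ^ 'n ^ 'n" where
  "diag l = (\<chi> i j. if i = j then l $ i else 0)"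

lemma eigenvalue_vector_diag: "eigenvalue_vector (diag l) (l :: real ^ 'n)"
  unfolding eigenvalue_vector_def
proof
  fix t
  have "det (mat t - diag l) = (\<Prod>i\<in>UNIV. (mat t - diag l) $ i $ i)"
    by (rule det_diagonal) (simp add: mat_def diag_def)
  then show "det (mat t - diag l) = (\<Prod>i\<in>UNIV. t - l $ i)"
    by (simp add: mat_def diag_def)
qed

lemma diag_add_sym_unit: "diag l + t *\<^sub>R sym_unit i i = diag (l + t *\<^sub>R axis i 1)"
  by (auto simp: vec_eq_iff diag_def sym_unit_def axis_def)

text \<open>Both products are the characteristic polynomial, so they have the same zeros. Ranges
  forget multiplicities but still determine the \<open>Min\<close> and \<open>Max\<close> in
  \<open>P2_half\<close>.\<close>

lemma range_eigenvalue_vector_unique: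
  assumes "eigenvalue_vector A l" "eigenvalue_vector A m"
  shows "range (($) l) = range (($) m)"
proof -
  have eq: "(\<Prod>i\<in>UNIV. t - l $ i) = (\<Prod>i\<in>UNIV. t - m $ i)" for t
    using assms by (simp add: eigenvalue_vector_def)
  have "(\<exists>i. t = l $ i) \<longleftrightarrow> (\<exists>i. t = m $ i)" for t
    using eq[of t] prod_zero_iff[of UNIV "\<lambda>i. t - l $ i"] prod_zero_iff[of UNIV "\<lambda>i. t - m $ i"]
    by (metis UNIV_I eq_iff_diff_eq_0 finite)
  then show ?thesis by (auto simp: image_def)
qed

text \<open>The factors of \<open>f\<close> are \<open>tr A - \<lambda>\<^sub>i\<close>.\<close>

lemma f_op_eq_det:
  assumes "eigenvalue_vector A m"
  shows "f_op m = det (mat (trace A) - A)"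
proof -
  have prod3: "(\<Prod>i\<in>UNIV. t - m $ i) = (t - m $ 1) * (t - m $ 2) * (t - m $ 3)" for t
    unfolding UNIV_3 by simp
  have e: "det (mat t - A) = (t - m $ 1) * (t - m $ 2) * (t - m $ 3)" for t
    using assms unfolding eigenvalue_vector_def prod3 by blast
  have entries: "(mat t - A) $ i $ j = (if i = j then t else 0) - A $ i $ j" for t i j
    by (simp add: mat_def)
  \<comment> \<open>The second difference of a monic cubic at 0 isolates its quadratic coefficient,
    here minus the trace.\<close>
  have tr: "trace A = m $ 1 + m $ 2 + m $ 3"
    using e[of 0] e[of 1] e[of "-1"] unfolding det_3 entries trace_def sum_3
    by (simp add: algebra_simps)
  show ?thesis
    unfolding e tr by (simp add: f_op_def algebra_simps)
qed

text \<open>By the determinant formula \<open>f_op\<close> agrees on all eigenvalue vectors of a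
  matrix, so the choice made by \<open>SOME\<close> is immaterial.\<close>

lemma F_op_diag: "F_op (diag l) = f_op l"
proof -
  have "eigenvalue_vector (diag l) (SOME m. eigenvalue_vector (diag l) m)"
    by (rule someI) (rule eigenvalue_vector_diag)
  then show ?thesis
    unfolding F_op_def using f_op_eq_det eigenvalue_vector_diag by metis
qed

section \<open>Derivatives of \<open>F_op\<close> at diagonal matrices\<close>

definition df_op :: "3 \<Rightarrow> real ^ 3 \<Rightarrow> real" where
  "df_op p l =
    (if p = 1 then (l $ 2 + l $ 3) * ((l $ 1 + l $ 2) + (l $ 1 + l $ 3))
     else if p = 2 then (l $ 1 + l $ 3) * ((l $ 1 + l $ 2) + (l $ 2 + l $ 3))
     else (l $ 1 + l $ 2) * ((l $ 1 + l $ 3) + (l $ 2 + l $ 3)))"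

text \<open>All mixed second derivatives of \<open>f_op\<close> coincide: each is the sum of the
  three factors.\<close>

definition ddf_op :: "3 \<Rightarrow> 3 \<Rightarrow> real ^ 3 \<Rightarrow> real" where
  "ddf_op p q l =
    (if p = q then 2 * (l $ 1 + l $ 2 + l $ 3 - l $ p) else 2 * (l $ 1 + l $ 2 + l $ 3))"

text \<open>Perturbing a diagonal entry keeps the matrix diagonal, so \<open>F_op\<close> is
  \<open>f_op\<close> along the whole line.\<close>

lemma F1_diag: "F1 p p (diag l) = df_op p l"
  unfolding F1_def entry_deriv_def diag_add_sym_unit F_op_diag f_op_def
    vector_add_component vector_scaleR_component real_scaleR_def
  by (rule DERIV_imp_deriv, (rule derivative_eq_intros refl)+)
    (use exhaust_3[of p] in \<open>auto simp: df_op_def axis_def algebra_simps\<close>)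

lemma F2_diag: "F2 p p q q (diag l) = ddf_op p q l"
proof -
  have "F2 p p q q (diag l) = deriv (\<lambda>t. F1 p p (diag (l + t *\<^sub>R axis q 1))) 0"
    by (simp add: F2_def entry_deriv_def[of q q] diag_add_sym_unit F1_def)
  also have "\<dots> = deriv (\<lambda>t. df_op p (l + t *\<^sub>R axis q 1)) 0"
    by (simp add: F1_diag)
  also have "\<dots> = ddf_op p q l"
  proof (rule DERIV_imp_deriv)
    consider "p = 1" | "p = 2" | "p = 3"
      using exhaust_3[of p] by blast
    then show "((\<lambda>t. df_op p (l + t *\<^sub>R axis q 1)) has_real_derivative ddf_op p q l) (at 0)"
    proof cases
      case 1
      show ?thesis
        unfolding 1 df_op_def vector_add_component vector_scaleR_component real_scaleR_def
        by (simp, (rule derivative_eq_intros refl)+)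
          (use exhaust_3[of q] in \<open>auto simp: ddf_op_def axis_def algebra_simps\<close>)
    next
      case 2
      show ?thesis
        unfolding 2 df_op_def vector_add_component vector_scaleR_component real_scaleR_def
        by (simp, (rule derivative_eq_intros refl)+)
          (use exhaust_3[of q] in \<open>auto simp: ddf_op_def axis_def algebra_simps\<close>)
    next
      case 3
      show ?thesis
        unfolding 3 df_op_def vector_add_component vector_scaleR_component real_scaleR_def
        by (simp, (rule derivative_eq_intros refl)+)
          (use exhaust_3[of q] in \<open>auto simp: ddf_op_def axis_def algebra_simps\<close>)
    qed
  qed
  finally show ?thesis .
qed

section \<open>Differentiating the equation\<close>

lemma partial_deriv_has_real_derivative:
  assumes "open U" "v differentiable_on U" "x \<in> U"
  shows "((\<lambda>t. v (x + t *\<^sub>R axis i 1)) has_real_derivative partial_deriv i v x) (at 0)"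
proof -
  have "v differentiable at x"
    using assms by (simp add: differentiable_on_eq_differentiable_at)
  then have "v differentiable at (x + 0 *\<^sub>R axis i 1)"
    by simp
  moreover have "(\<lambda>t::real. x + t *\<^sub>R axis i 1) differentiable at 0"
    by (auto intro!: derivative_intros)
  ultimately have "(\<lambda>t. v (x + t *\<^sub>R axis i 1)) differentiable at 0"
    using differentiable_chain_at[of "\<lambda>t::real. x + t *\<^sub>R axis i 1" 0 v] by (simp add: o_def)
  then have "(\<lambda>t. v (x + t *\<^sub>R axis i 1)) field_differentiable at 0"
    by (simp add: field_differentiable_def real_differentiable_def)
  then show ?thesis
    by (simp add: partial_deriv_def field_differentiable_derivI)
qed

lemma smooth_on_hessian_differentiable:
  assumes "smooth_on u U"
  shows "(\<lambda>x. hessian u x $ i $ j) differentiable_on U"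
proof -
  have "Ck_on 3 u U"
    using assms by (simp add: smooth_on_def)
  then show ?thesis
    by (simp add: hessian_def numeral_3_eq_3)
qed

text \<open>At a diagonal matrix the off-diagonal entries do not contribute, because every product in the
  expansion of the determinant contains none or at least two of them.\<close>

lemma linearized_equation:
  fixes u :: "real ^ 3 \<Rightarrow> real"
  assumes "open U" "smooth_on u U" "x0 \<in> U"
    and eq: "\<And>x. x \<in> U \<Longrightarrow> det (mat (trace (hessian u x)) - hessian u x) = 1"
    and hess: "hessian u x0 = diag l"
  shows "(\<Sum>i\<in>UNIV. df_op i l * partial_deriv k (partial_deriv i (partial_deriv i u)) x0) = 0"
proof -
  define h where "h i j t = hessian u (x0 + t *\<^sub>R axis k 1) $ i $ j" for i j t
  define d where "d i j = partial_deriv k (partial_deriv j (partial_deriv i u)) x0" for i j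
  define \<Phi> where "\<Phi> t = det (mat (trace (hessian u (x0 + t *\<^sub>R axis k 1)))
    - hessian u (x0 + t *\<^sub>R axis k 1))" for t
  have h0: "h i j 0 = (if i = j then l $ i else 0)" for i j
    by (simp add: h_def hess diag_def)
  have dh: "(h i j has_real_derivative d i j) (at 0)" for i j
    using partial_deriv_has_real_derivative
      [OF \<open>open U\<close> smooth_on_hessian_differentiable[OF \<open>smooth_on u U\<close>, of i j] \<open>x0 \<in> U\<close>, where i = k]
    by (simp add: h_def[abs_def] d_def hessian_def)
  have \<Phi>: "\<Phi> t =
      (h 2 2 t + h 3 3 t) * (h 1 1 t + h 3 3 t) * (h 1 1 t + h 2 2 t)
      - h 1 2 t * h 2 3 t * h 3 1 t - h 1 3 t * h 2 1 t * h 3 2 t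
      - (h 2 2 t + h 3 3 t) * h 2 3 t * h 3 2 t
      - (h 1 1 t + h 2 2 t) * h 1 2 t * h 2 1 t
      - (h 1 1 t + h 3 3 t) * h 1 3 t * h 3 1 t" for t
    by (simp add: \<Phi>_def det_3 trace_def sum_3 mat_def h_def algebra_simps)
  have "(\<Phi> has_real_derivative (\<Sum>i\<in>UNIV. df_op i l * d i i)) (at 0)"
    unfolding \<Phi>[abs_def]
    by (rule derivative_eq_intros dh refl)+ (simp add: h0 sum_3 df_op_def algebra_simps)
  moreover have "(\<Phi> has_real_derivative 0) (at 0)"
  \<comment> \<open>The equation makes \<open>\<Phi>\<close> equal to 1 only while the line stays in
    \<open>U\<close>, hence near 0.\<close>
  proof (rule DERIV_cong_ev[THEN iffD1, OF refl _ refl DERIV_const[of 1]])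
    have "((\<lambda>t. x0 + t *\<^sub>R axis k 1) \<longlongrightarrow> x0 + 0 *\<^sub>R axis k 1) (nhds (0::real))"
      by (intro tendsto_intros filterlim_ident)
    then have "eventually (\<lambda>t::real. x0 + t *\<^sub>R axis k 1 \<in> U) (nhds 0)"
      using assms(1,3) by (intro topological_tendstoD) auto
    then show "eventually (\<lambda>t. 1 = \<Phi> t) (nhds 0)"
      by (rule eventually_mono) (simp add: \<Phi>_def eq)
  qed
  ultimately show ?thesis
    unfolding d_def by (rule DERIV_unique)
qed

section \<open>The algebraic inequality\<close>

text \<open>Here \<open>L\<close> stands for the largest eigenvalue; \<open>b - a\<close> and
  \<open>c - a\<close> are its gaps to the second and third, positive because
  \<open>a \<le> 1 / 4\<close>.\<close>

lemma quadratic_form_nonneg: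
  fixes a b c x\<^sub>1 x\<^sub>2 x\<^sub>3 L :: real
  assumes b: "b \<ge> 2" and c: "c \<ge> 2" and abc: "a * b * c = 1"
    and L: "L \<ge> 4" and bc: "b + c = 2 * L + a"
    and lin: "a * (b + c) * x\<^sub>1 + b * (a + c) * x\<^sub>2 + c * (a + b) * x\<^sub>3 = 0"
  shows "10 / 9 * (a * (b + c) * x\<^sub>1\<^sup>2 / L) \<le>
     2 * (b * (a + c) * x\<^sub>2\<^sup>2 / (b - a) + c * (a + b) * x\<^sub>3\<^sup>2 / (c - a))
     - 2 * (a * (x\<^sub>1 + x\<^sub>2) * (x\<^sub>1 + x\<^sub>3) + b * (x\<^sub>1 + x\<^sub>2) * (x\<^sub>2 + x\<^sub>3)
         + c * (x\<^sub>1 + x\<^sub>3) * (x\<^sub>2 + x\<^sub>3))"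
proof -
  have bc4: "b * c \<ge> 4" using mult_mono[OF b c] b c by simp
  have a_eq: "a = 1 / (b * c)" using abc b c by (simp add: field_simps)
  have a0: "a > 0" using a_eq b c by simp
  have a4: "a \<le> 1 / 4" using a_eq bc4 by (simp add: field_simps)
  \<comment> \<open>These play the role of logarithmic derivatives of \<open>a\<close>,
    \<open>b\<close>, \<open>c\<close>; they sum to 0 because the product is constant.\<close>
  define x y z where "x = (x\<^sub>2 + x\<^sub>3) / a" and "y = (x\<^sub>1 + x\<^sub>3) / b" and "z = (x\<^sub>1 + x\<^sub>2) / c"
  have xyz: "x\<^sub>2 + x\<^sub>3 = a * x" "x\<^sub>1 + x\<^sub>3 = b * y" "x\<^sub>1 + x\<^sub>2 = c * z"
    using a0 b c by (auto simp: x_def y_def z_def)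
  have "b * c * (x\<^sub>2 + x\<^sub>3) + a * c * (x\<^sub>1 + x\<^sub>3) + a * b * (x\<^sub>1 + x\<^sub>2) = 0"
    using lin by (simp add: algebra_simps)
  then have "a * b * c * (x + y + z) = 0"
    unfolding xyz by (simp add: algebra_simps)
  then have x: "x = - y - z"
    using abc by simp
  have "a * (x\<^sub>1 + x\<^sub>2) * (x\<^sub>1 + x\<^sub>3) + b * (x\<^sub>1 + x\<^sub>2) * (x\<^sub>2 + x\<^sub>3) + c * (x\<^sub>1 + x\<^sub>3) * (x\<^sub>2 + x\<^sub>3)
    = a * b * c * (y * z + x * z + x * y)"
    unfolding xyz by (simp add: algebra_simps)
  also have "\<dots> = - (y\<^sup>2 + y * z + z\<^sup>2)"
    unfolding abc x by (simp add: power2_eq_square algebra_simps)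
  finally have hess: "a * (x\<^sub>1 + x\<^sub>2) * (x\<^sub>1 + x\<^sub>3) + b * (x\<^sub>1 + x\<^sub>2) * (x\<^sub>2 + x\<^sub>3)
    + c * (x\<^sub>1 + x\<^sub>3) * (x\<^sub>2 + x\<^sub>3) = - (y\<^sup>2 + y * z + z\<^sup>2)" .
  have "y * z = a * ((x\<^sub>1 + x\<^sub>3) * (x\<^sub>1 + x\<^sub>2))"
    unfolding y_def z_def a_eq by simp
  \<comment> \<open>The two sides differ by \<open>a\<close> times the square of the sum of the
    three variables.\<close>
  moreover have "a * (x\<^sub>1\<^sup>2 - x\<^sub>2\<^sup>2 - x\<^sub>3\<^sup>2) \<le> a * (2 * ((x\<^sub>1 + x\<^sub>3) * (x\<^sub>1 + x\<^sub>2)))"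
    using zero_le_power2[of "x\<^sub>1 + x\<^sub>2 + x\<^sub>3"] a0
    by (intro mult_left_mono) (simp_all add: power2_eq_square algebra_simps)
  ultimately have "a * (x\<^sub>1\<^sup>2 - x\<^sub>2\<^sup>2 - x\<^sub>3\<^sup>2) \<le> 2 * (y * z)"
    by simp
  moreover have "3 * (y * z) \<le> y\<^sup>2 + y * z + z\<^sup>2"
    using zero_le_power2[of "y - z"] by (simp add: power2_eq_square algebra_simps)
  ultimately have E: "3 * a * (x\<^sub>1\<^sup>2 - x\<^sub>2\<^sup>2 - x\<^sub>3\<^sup>2) \<le> 2 * (y\<^sup>2 + y * z + z\<^sup>2)"
    by (simp add: algebra_simps)
  \<comment> \<open>The quotient is \<open>2 + a / L\<close>, at most
    \<open>2 + 1 / 16\<close>.\<close>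
  have "10 / 9 * ((b + c) / L) \<le> 3"
    using bc L a4 by (simp add: field_simps)
  then have "10 / 9 * ((b + c) / L) * (a * x\<^sub>1\<^sup>2) \<le> 3 * (a * x\<^sub>1\<^sup>2)"
    by (rule mult_right_mono) (use a0 in simp)
  then have T: "10 / 9 * (a * (b + c) * x\<^sub>1\<^sup>2 / L) \<le> 3 * a * x\<^sub>1\<^sup>2"
    by (simp add: field_simps)
  \<comment> \<open>Since \<open>0 < p - a < p\<close>, the factor
    \<open>p * (a + q) / (p - a)\<close> exceeds \<open>a + q\<close>, hence 2, while
    \<open>3 / 2 * a\<close> is at most \<open>3 / 8\<close>.\<close>
  have S: "3 * a * s \<le> 2 * (p * (a + q) * s / (p - a))"
    if "p \<ge> 2" "q \<ge> 2" "s \<ge> 0" for p q s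
  proof -
    have "3 / 2 * a * (p - a) \<le> 3 / 2 * a * p"
      using a0 by simp
    also have "\<dots> \<le> p * (a + q)"
      using that a0 a4 mult_left_mono[of "3 / 2 * a" "a + q" p] by (simp add: mult_ac)
    finally have "3 / 2 * a \<le> p * (a + q) / (p - a)"
      using that a4 by (simp add: pos_le_divide_eq)
    then have "3 / 2 * a * s \<le> p * (a + q) / (p - a) * s"
      using that by (intro mult_right_mono)
    then show ?thesis by (simp add: mult_ac)
  qed
  show ?thesis
    using E T S[of b c "x\<^sub>2\<^sup>2"] S[of c b "x\<^sub>3\<^sup>2"] b c unfolding hess
    by (simp add: algebra_simps)
qed

theorem lemma2p3:
  fixes \<epsilon> :: real
  assumes "\<epsilon> = 1 / 9"
  shows "\<exists>\<Lambda>::real. \<Lambda> > 0 \<and>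
    (\<forall>(U :: (real ^ 3) set) (u :: real ^ 3 \<Rightarrow> real) (x0 :: real ^ 3) (l :: real ^ 3) (\<xi> :: real ^ 3).
      open U \<longrightarrow> smooth_on u U \<longrightarrow>
      (\<forall>x\<in>U. \<exists>m. eigenvalue_vector (hessian u x) m \<and> m \<in> P2_half \<and> f_op m = 1) \<longrightarrow>
      x0 \<in> U \<longrightarrow>
      (\<forall>i j. hessian u x0 $ i $ j = (if i = j then l $ i else 0)) \<longrightarrow>
      l $ 1 = Max (range (($) l)) \<longrightarrow>
      l $ 1 \<ge> \<Lambda> \<longrightarrow>
      (\<forall>i. \<xi> $ i = partial_deriv 1 (partial_deriv i (partial_deriv i u)) x0) \<longrightarrow>
      - (\<Sum>p\<in>UNIV. \<Sum>q\<in>UNIV. F2 p p q q (hessian u x0) * \<xi> $ p * \<xi> $ q)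
        + 2 * (\<Sum>i\<in>{2, 3}. F1 i i (hessian u x0) * (\<xi> $ i)\<^sup>2 / (l $ 1 - l $ i))
        - (1 + \<epsilon>) * (F1 1 1 (hessian u x0) * (\<xi> $ 1)\<^sup>2 / l $ 1) \<ge> 0)"
\<comment> \<open>The value 4 makes \<open>b\<close> and \<open>c\<close>, which are at least half
  of \<open>l $ 1\<close>, at least 2.\<close>
proof (rule exI[of _ 4], intro conjI allI impI)
  show "(4::real) > 0" by simp
next
  fix U :: "(real ^ 3) set" and u :: "real ^ 3 \<Rightarrow> real" and x0 l \<xi> :: "real ^ 3"
  assume U: "open U" "smooth_on u U"
    and ev: "\<forall>x\<in>U. \<exists>m. eigenvalue_vector (hessian u x) m \<and> m \<in> P2_half \<and> f_op m = 1"
    and x0: "x0 \<in> U"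
    and hess: "\<forall>i j. hessian u x0 $ i $ j = (if i = j then l $ i else 0)"
    and lmax: "l $ 1 = Max (range (($) l))"
    and L: "l $ 1 \<ge> 4"
    and \<xi>: "\<forall>i. \<xi> $ i = partial_deriv 1 (partial_deriv i (partial_deriv i u)) x0"
  have D: "hessian u x0 = diag l"
    using hess by (simp add: diag_def vec_eq_iff)
  \<comment> \<open>\<open>m\<close> may list the entries of \<open>l\<close> in another order, so
    its properties are carried over to \<open>l\<close> through the determinant and the
    range.\<close>
  obtain m where m: "eigenvalue_vector (diag l) m" "m \<in> P2_half" "f_op m = 1"
    using ev x0 D by metis
  have fl: "f_op l = 1"
    using m(1,3) f_op_eq_det eigenvalue_vector_diag by metis
  have "Min (range (($) m)) \<ge> - (1 / 2) * Max (range (($) m))"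
    using m(2) by (simp only: P2_half_def mem_Collect_eq)
  then have "Min (range (($) l)) \<ge> - (1 / 2) * l $ 1"
    by (simp only: range_eigenvalue_vector_unique[OF m(1) eigenvalue_vector_diag] lmax)
  moreover have "Min (range (($) l)) \<le> l $ i" for i
    by simp
  ultimately have lower: "l $ i \<ge> - (1 / 2) * l $ 1" for i
    by (meson order_trans)
  define a b c where "a = l $ 2 + l $ 3" and "b = l $ 1 + l $ 3" and "c = l $ 1 + l $ 2"
  have "(\<Sum>i\<in>UNIV. df_op i l * \<xi> $ i) = 0"
    unfolding \<xi>[THEN spec]
  proof (rule linearized_equation[OF U x0 _ D])
    fix x assume "x \<in> U"
    then show "det (mat (trace (hessian u x)) - hessian u x) = 1"
      using ev f_op_eq_det by metis
  qed
  then have lin: "a * (b + c) * \<xi> $ 1 + b * (a + c) * \<xi> $ 2 + c * (a + b) * \<xi> $ 3 = 0"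
    by (simp add: sum_3 df_op_def a_def b_def c_def add_ac)
  have "10 / 9 * (a * (b + c) * (\<xi> $ 1)\<^sup>2 / l $ 1) \<le>
     2 * (b * (a + c) * (\<xi> $ 2)\<^sup>2 / (b - a) + c * (a + b) * (\<xi> $ 3)\<^sup>2 / (c - a))
     - 2 * (a * (\<xi> $ 1 + \<xi> $ 2) * (\<xi> $ 1 + \<xi> $ 3) + b * (\<xi> $ 1 + \<xi> $ 2) * (\<xi> $ 2 + \<xi> $ 3)
         + c * (\<xi> $ 1 + \<xi> $ 3) * (\<xi> $ 2 + \<xi> $ 3))"
  proof (rule quadratic_form_nonneg[OF _ _ _ L _ lin])
    show "b \<ge> 2" "c \<ge> 2"
      using lower[of 3] lower[of 2] L by (auto simp: b_def c_def)
    show "a * b * c = 1" "b + c = 2 * l $ 1 + a"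
      using fl by (auto simp: f_op_def a_def b_def c_def mult_ac)
  qed
  moreover have "(\<Sum>p\<in>UNIV. \<Sum>q\<in>UNIV. F2 p p q q (hessian u x0) * \<xi> $ p * \<xi> $ q) =
      2 * (a * (\<xi> $ 1 + \<xi> $ 2) * (\<xi> $ 1 + \<xi> $ 3) + b * (\<xi> $ 1 + \<xi> $ 2) * (\<xi> $ 2 + \<xi> $ 3)
         + c * (\<xi> $ 1 + \<xi> $ 3) * (\<xi> $ 2 + \<xi> $ 3))"
    unfolding D F2_diag by (simp add: sum_3 ddf_op_def a_def b_def c_def algebra_simps)
  moreover have "(\<Sum>i\<in>{2, 3}. F1 i i (hessian u x0) * (\<xi> $ i)\<^sup>2 / (l $ 1 - l $ i)) =
      b * (a + c) * (\<xi> $ 2)\<^sup>2 / (b - a) + c * (a + b) * (\<xi> $ 3)\<^sup>2 / (c - a)"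
    unfolding D F1_diag by (simp add: df_op_def a_def b_def c_def add_ac)
  moreover have "F1 1 1 (hessian u x0) = a * (b + c)"
    unfolding D F1_diag by (simp add: df_op_def a_def b_def c_def add_ac)
  moreover have eps: "1 + \<epsilon> = 10 / 9"
    using assms by simp
  ultimately show "- (\<Sum>p\<in>UNIV. \<Sum>q\<in>UNIV. F2 p p q q (hessian u x0) * \<xi> $ p * \<xi> $ q)
        + 2 * (\<Sum>i\<in>{2, 3}. F1 i i (hessian u x0) * (\<xi> $ i)\<^sup>2 / (l $ 1 - l $ i))
        - (1 + \<epsilon>) * (F1 1 1 (hessian u x0) * (\<xi> $ 1)\<^sup>2 / l $ 1) \<ge> 0"
    unfolding eps by (simp only: diff_ge_0_iff_ge uminus_add_conv_diff)
qed

end
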